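(* Let $G$ be a finite simple graph on $n$ vertices and $m$ edges, with maximum vertex degree $\Delta$ and minimum vertex degree $\delta$, and let $\alpha$ be a real number. Then $$\frac{2^{\alpha/2}}{\Delta^\alpha}R_\alpha(G)\leq SO_\alpha(G)\leq \frac{2^{\alpha/2}}{\delta^\alpha}R_\alpha(G),$$ where equality holds if and only if $G$ is regular.
   Context: All graphs are finite and simple. $d_G(u)$ denotes the degree of the vertex $u$ in $G$. For any real number $\alpha$, the general Sombor index is $SO_\alpha(G)=\sum_{uv\in E(G)}[d_G(u)^2+d_G(v)^2]^{\alpha/2}$ and the general Randić index is $R_\alpha(G)=\sum_{uv\in E(G)}[d_G(u)d_G(v)]^\alpha$. A graph is regular if all its vertices have the same degree.
   Formalization: The claim is false for α<0 (path P_3, α=-2), so there both inequalities are reversed; at α=0 equality always holds, so "equality iff regular" is stated only for α≠0; G is nonempty with δ>0, since otherwise the right bound is undefined or the claim fails. *)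

theory Defs
  imports Complex_Main
begin

definition simple_graph :: "'a set \<Rightarrow> 'a set set \<Rightarrow> bool" where
  "simple_graph V E \<longleftrightarrow> finite V \<and> (\<forall>e\<in>E. e \<subseteq> V \<and> card e = 2)"

definition degree :: "'a set set \<Rightarrow> 'a \<Rightarrow> nat" where
  "degree E u = card {e \<in> E. u \<in> e}"

text \<open>The following two notions are meaningful only for a finite nonempty vertex set.\<close>

definition max_degree :: "'a set \<Rightarrow> 'a set set \<Rightarrow> nat" where
  "max_degree V E = Max (degree E ` V)"

definition min_degree :: "'a set \<Rightarrow> 'a set set \<Rightarrow> nat" where
  "min_degree V E = Min (degree E ` V)"

definition regular_graph :: "'a set \<Rightarrow> 'a set set \<Rightarrow> bool" where
  "regular_graph V E \<longleftrightarrow> (\<exists>k. \<forall>u\<in>V. degree E u = k)"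

text \<open>An edge is a two-element set \<open>e = {u, v}\<close> with \<open>u \<noteq> v\<close>, so the inner sum below is
  \<open>d(u)^2 + d(v)^2\<close> and the inner product is \<open>d(u) * d(v)\<close>. Both are positive, because the end
  points of an edge have degree at least one, so \<open>powr\<close> is the usual real power for every
  real exponent.\<close>

definition general_sombor :: "real \<Rightarrow> 'a set set \<Rightarrow> real" where
  "general_sombor \<alpha> E = (\<Sum>e\<in>E. (\<Sum>u\<in>e. (real (degree E u))\<^sup>2) powr (\<alpha> / 2))"

definition general_randic :: "real \<Rightarrow> 'a set set \<Rightarrow> real" where
  "general_randic \<alpha> E = (\<Sum>e\<in>E. (\<Prod>u\<in>e. real (degree E u)) powr \<alpha>)"

end

theory Submission
  imports Defs
begin

text \<open>
  For an edge with end degrees \<open>a\<close>, \<open>b\<close>, the term of the scaled Randic index with scale \<open>d\<close> is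
  the power with exponent \<open>\<alpha> / 2\<close> of \<open>2 a\<^sup>2 b\<^sup>2 / d\<^sup>2\<close>, to be compared with \<open>a\<^sup>2 + b\<^sup>2\<close>. Their quotient
  compares \<open>2 / d\<^sup>2\<close> with \<open>1 / a\<^sup>2 + 1 / b\<^sup>2\<close>, so the bases are ordered when \<open>d\<close> is an extreme degree and
  they agree only if \<open>a = b = d\<close>. As \<open>\<delta> > 0\<close>, every vertex lies on an edge, so termwise equality
  forces regularity.
\<close>

text \<open>After multiplying by \<open>C\<close>, the claim is the sum of
  \<open>A * B \<le> A * C\<close> and \<open>A * B \<le> B * C\<close>. Equality in the sum forces
  equality in both, and the positive factors \<open>A\<close>, \<open>B\<close> cancel. It serves
  with squared degrees for \<open>A\<close>, \<open>B\<close> and the squared maximum degree for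
  \<open>C\<close>.\<close>

lemma two_mult_divide_le_add:
  fixes A B C :: real
  assumes "0 < A" "0 < B" "A \<le> C" "B \<le> C"
  shows "2 * (A * B) / C \<le> A + B" and "2 * (A * B) / C = A + B \<longleftrightarrow> A = C \<and> B = C"
proof -
  have C: "C > 0" using assms by simp
  have l: "A * B \<le> A * C" and r: "A * B \<le> B * C"
    using assms by (auto simp: mult.commute intro: mult_left_mono)
  show "2 * (A * B) / C \<le> A + B"
    using l r C by (simp add: divide_simps algebra_simps)
  have "2 * (A * B) / C = A + B \<longleftrightarrow> 2 * (A * B) = A * C + B * C"
    using C by (simp add: divide_simps distrib_right)
  also have "\<dots> \<longleftrightarrow> A * B = A * C \<and> A * B = B * C"
    using l r by linarith
  finally have "2 * (A * B) / C = A + B \<longleftrightarrow> A * B = A * C \<and> A * B = B * C" .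
  then show "2 * (A * B) / C = A + B \<longleftrightarrow> A = C \<and> B = C"
    using assms by auto
qed

text \<open>The mirror image with \<open>C\<close> as a lower bound, for the minimum degree: both
  product inequalities reverse.\<close>

lemma add_le_two_mult_divide:
  fixes A B C :: real
  assumes "0 < C" "C \<le> A" "C \<le> B"
  shows "A + B \<le> 2 * (A * B) / C" and "A + B = 2 * (A * B) / C \<longleftrightarrow> A = C \<and> B = C"
proof -
  have l: "A * C \<le> A * B" and r: "B * C \<le> A * B"
    using assms by (auto simp: mult.commute intro: mult_left_mono)
  have pos: "0 < A" "0 < B" using assms by simp_all
  show "A + B \<le> 2 * (A * B) / C"
    using l r assms(1) by (simp add: divide_simps algebra_simps)
  have "A + B = 2 * (A * B) / C \<longleftrightarrow> A * C + B * C = 2 * (A * B)"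
    using assms(1) by (simp add: divide_simps distrib_right)
  also have "\<dots> \<longleftrightarrow> A * C = A * B \<and> B * C = A * B"
    using l r by linarith
  finally have "A + B = 2 * (A * B) / C \<longleftrightarrow> A * C = A * B \<and> B * C = A * B" .
  then show "A + B = 2 * (A * B) / C \<longleftrightarrow> A = C \<and> B = C"
    using pos by auto
qed

text \<open>On positive bases a power with nonzero exponent is strictly monotone, so the sign of
  \<open>p\<close> decides only the direction. Sums of termwise ordered powers agree only if all
  terms agree, hence all bases.\<close>

lemma sum_powr_compare:
  fixes x y :: "'b \<Rightarrow> real"
  assumes "finite I" and pos: "\<And>i. i \<in> I \<Longrightarrow> 0 < x i" and le: "\<And>i. i \<in> I \<Longrightarrow> x i \<le> y i"
  shows sum_powr_mono: "0 \<le> p \<Longrightarrow> (\<Sum>i\<in>I. x i powr p) \<le> (\<Sum>i\<in>I. y i powr p)"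
    and sum_powr_antimono: "p \<le> 0 \<Longrightarrow> (\<Sum>i\<in>I. y i powr p) \<le> (\<Sum>i\<in>I. x i powr p)"
    and sum_powr_eq_iff:
      "p \<noteq> 0 \<Longrightarrow> (\<Sum>i\<in>I. x i powr p) = (\<Sum>i\<in>I. y i powr p) \<longleftrightarrow> (\<forall>i\<in>I. x i = y i)"
proof -
  have mono: "x i powr p \<le> y i powr p" if "0 \<le> p" "i \<in> I" for i
    using that pos[of i] le[of i] by (simp add: powr_mono2)
  have antimono: "y i powr p \<le> x i powr p" if "p \<le> 0" "i \<in> I" for i
    using that pos[of i] le[of i] by (simp add: powr_mono2')
  show "0 \<le> p \<Longrightarrow> (\<Sum>i\<in>I. x i powr p) \<le> (\<Sum>i\<in>I. y i powr p)"
    using mono by (simp add: sum_mono)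
  show "p \<le> 0 \<Longrightarrow> (\<Sum>i\<in>I. y i powr p) \<le> (\<Sum>i\<in>I. x i powr p)"
    using antimono by (simp add: sum_mono)
  assume "p \<noteq> 0"
  show "(\<Sum>i\<in>I. x i powr p) = (\<Sum>i\<in>I. y i powr p) \<longleftrightarrow> (\<forall>i\<in>I. x i = y i)"
  proof
    assume eq: "(\<Sum>i\<in>I. x i powr p) = (\<Sum>i\<in>I. y i powr p)"
    have "x i powr p = y i powr p" if "i \<in> I" for i
    proof (cases "p \<ge> 0")
      case True
      show ?thesis by (rule sum_mono_inv[OF eq mono[OF True] that \<open>finite I\<close>])
    next
      case False
      then have "p \<le> 0" by simp
      show ?thesis
        by (rule sum_mono_inv[OF eq[symmetric] antimono[OF \<open>p \<le> 0\<close>] that \<open>finite I\<close>, symmetric])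
    qed
    \<comment> \<open>Taking logarithms recovers the bases: \<open>p\<close> cancels and
      \<open>ln\<close> is injective on positive reals.\<close>
    then have "p * ln (x i) = p * ln (y i)" if "i \<in> I" for i
      using that by (metis ln_powr)
    then show "\<forall>i\<in>I. x i = y i"
      using \<open>p \<noteq> 0\<close> pos le by (metis ln_inj_iff mult_left_cancel order_less_le_trans)
  qed simp
qed

text \<open>Absorbs the scaling constant into the base and halves the exponent, so that Randic terms
  and Sombor terms are powers with the same exponent.\<close>

lemma powr_divide_mult_powr:
  fixes d P :: real
  assumes "0 < d" "0 \<le> P"
  shows "2 powr (\<alpha> / 2) / d powr \<alpha> * P powr \<alpha> = (2 * P\<^sup>2 / d\<^sup>2) powr (\<alpha> / 2)"
proof -
  have sq: "(z\<^sup>2) powr (\<alpha> / 2) = z powr \<alpha>" if "0 \<le> z" for z :: real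
  proof -
    have "z\<^sup>2 = z powr 2" using that by simp
    then show ?thesis by (simp only: powr_powr) simp
  qed
  show ?thesis
    using assms by (simp add: powr_divide powr_mult sq)
qed

theorem theorem4p1:
  fixes V :: "'a set" and E :: "'a set set" and \<alpha> :: real and \<Delta> \<delta> :: nat
  assumes "simple_graph V E" and "V \<noteq> {}"
    and "\<Delta> = max_degree V E" and "\<delta> = min_degree V E"
    and "\<delta> > 0"
  shows "(\<alpha> \<ge> 0 \<longrightarrow>
           2 powr (\<alpha> / 2) / real \<Delta> powr \<alpha> * general_randic \<alpha> E \<le> general_sombor \<alpha> E \<and>
           general_sombor \<alpha> E \<le> 2 powr (\<alpha> / 2) / real \<delta> powr \<alpha> * general_randic \<alpha> E) \<and>
         (\<alpha> < 0 \<longrightarrow>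
           2 powr (\<alpha> / 2) / real \<delta> powr \<alpha> * general_randic \<alpha> E \<le> general_sombor \<alpha> E \<and>
           general_sombor \<alpha> E \<le> 2 powr (\<alpha> / 2) / real \<Delta> powr \<alpha> * general_randic \<alpha> E) \<and>
         (\<alpha> \<noteq> 0 \<longrightarrow>
           (2 powr (\<alpha> / 2) / real \<Delta> powr \<alpha> * general_randic \<alpha> E = general_sombor \<alpha> E
              \<longleftrightarrow> regular_graph V E) \<and>
           (general_sombor \<alpha> E = 2 powr (\<alpha> / 2) / real \<delta> powr \<alpha> * general_randic \<alpha> E
              \<longleftrightarrow> regular_graph V E))"
proof -
  have edge: "e \<subseteq> V" "card e = 2" if "e \<in> E" for e
    using assms(1) that by (auto simp: simple_graph_def)
  have finV: "finite V" using assms(1) by (simp add: simple_graph_def)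
  have "E \<subseteq> Pow V" using edge by auto
  then have finE: "finite E" using finV by (simp add: finite_subset)
  have deg_le: "degree E u \<le> \<Delta>" and deg_ge: "\<delta> \<le> degree E u" if "u \<in> V" for u
    using that finV assms(3,4) by (auto simp: max_degree_def min_degree_def)
  \<comment> \<open>Vertices attaining the extreme degrees turn "all degrees equal \<Delta>" (or
    \<delta>) into "all degrees equal that of one vertex".\<close>
  obtain uM um where uM: "uM \<in> V" "degree E uM = \<Delta>" and um: "um \<in> V" "degree E um = \<delta>"
  proof -
    have "\<Delta> \<in> degree E ` V" "\<delta> \<in> degree E ` V"
      using finV assms(2) unfolding assms(3,4) max_degree_def min_degree_def
      by (auto intro: Max_in Min_in)
    then show thesis using that by blast
  qed
  have "\<Delta> > 0" using deg_le[OF um(1)] um(2) assms(5) by simp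

  define S where "S e = (\<Sum>u\<in>e. (real (degree E u))\<^sup>2)" for e
  define T where "T d e = 2 * (\<Prod>u\<in>e. real (degree E u))\<^sup>2 / (real d)\<^sup>2" for d :: nat and e
  have sombor: "general_sombor \<alpha> E = (\<Sum>e\<in>E. S e powr (\<alpha> / 2))"
    by (simp add: general_sombor_def S_def)
  have randic: "2 powr (\<alpha> / 2) / real d powr \<alpha> * general_randic \<alpha> E = (\<Sum>e\<in>E. T d e powr (\<alpha> / 2))"
    if "d > 0" for d
    unfolding general_randic_def T_def sum_distrib_left
    by (intro sum.cong refl powr_divide_mult_powr) (use that in \<open>auto intro: prod_nonneg\<close>)

  \<comment> \<open>All comparisons are between bases and do not involve \<alpha>:
    \<open>T \<Delta> e \<le> S e \<le> T \<delta> e\<close>.\<close>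
  have bounds: "0 < T \<Delta> e" "T \<Delta> e \<le> S e" "0 < S e" "S e \<le> T \<delta> e"
    and eq_upper: "T \<Delta> e = S e \<longleftrightarrow> (\<forall>u\<in>e. degree E u = \<Delta>)"
    and eq_lower: "S e = T \<delta> e \<longleftrightarrow> (\<forall>u\<in>e. degree E u = \<delta>)"
    if eE: "e \<in> E" for e
  proof -
    obtain u v where e: "e = {u, v}" "u \<noteq> v" using edge(2)[OF eE] by (meson card_2_iff)
    define A B where "A = (real (degree E u))\<^sup>2" and "B = (real (degree E v))\<^sup>2"
    have uv: "u \<in> V" "v \<in> V" using e edge(1)[OF eE] by auto
    have S: "S e = A + B" and T: "T d e = 2 * (A * B) / (real d)\<^sup>2" for d
      using e by (auto simp: S_def T_def A_def B_def power_mult_distrib)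
    have le: "(real \<delta>)\<^sup>2 \<le> A" "(real \<delta>)\<^sup>2 \<le> B" "A \<le> (real \<Delta>)\<^sup>2" "B \<le> (real \<Delta>)\<^sup>2"
      using deg_le[OF uv(1)] deg_le[OF uv(2)] deg_ge[OF uv(1)] deg_ge[OF uv(2)]
      by (auto simp: A_def B_def intro: power_mono)
    have d: "0 < (real \<delta>)\<^sup>2" using assms(5) by simp
    have A: "0 < A" and B: "0 < B" using le d by linarith+
    show "0 < T \<Delta> e" "0 < S e" using A B \<open>\<Delta> > 0\<close> by (auto simp: S T)
    show "T \<Delta> e \<le> S e" unfolding S T by (rule two_mult_divide_le_add(1)[OF A B le(3,4)])
    show "S e \<le> T \<delta> e" unfolding S T by (rule add_le_two_mult_divide(1)[OF d le(1,2)])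
    show "T \<Delta> e = S e \<longleftrightarrow> (\<forall>u\<in>e. degree E u = \<Delta>)"
      unfolding S T two_mult_divide_le_add(2)[OF A B le(3,4)] by (simp add: A_def B_def e(1))
    show "S e = T \<delta> e \<longleftrightarrow> (\<forall>u\<in>e. degree E u = \<delta>)"
      unfolding S T add_le_two_mult_divide(2)[OF d le(1,2)] by (simp add: A_def B_def e(1))
  qed

  have covered: "\<exists>e\<in>E. u \<in> e" if "u \<in> V" for u
  proof -
    have "card {e \<in> E. u \<in> e} > 0"
      using deg_ge[OF that] assms(5) by (simp add: degree_def)
    then have "{e \<in> E. u \<in> e} \<noteq> {}" by (metis card.empty less_irrefl)
    then show ?thesis by blast
  qed
  \<comment> \<open>The termwise equality conditions see only end points of edges;
    \<open>covered\<close> extends them to all of \<open>V\<close>.\<close>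
  have regular: "(\<forall>e\<in>E. \<forall>u\<in>e. degree E u = degree E w) \<longleftrightarrow> regular_graph V E" if "w \<in> V" for w
    using covered edge(1) that unfolding regular_graph_def by (metis subsetD)

  \<comment> \<open>The exponent \<open>\<alpha> / 2\<close> has the sign of \<alpha>, which is why
    the two bounds swap for negative \<alpha>, while the equality criterion needs only
    \<open>\<alpha> \<noteq> 0\<close>.\<close>
  note upper = sum_powr_compare[OF finE bounds(1,2), where p = "\<alpha> / 2"]
  note lower = sum_powr_compare[OF finE bounds(3,4), where p = "\<alpha> / 2"]
  have "(\<forall>e\<in>E. T \<Delta> e = S e) \<longleftrightarrow> regular_graph V E"
    using eq_upper regular[OF uM(1)] uM(2) by simp
  moreover have "(\<forall>e\<in>E. S e = T \<delta> e) \<longleftrightarrow> regular_graph V E"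
    using eq_lower regular[OF um(1)] um(2) by simp
  ultimately show ?thesis
    using upper lower unfolding randic[OF \<open>\<Delta> > 0\<close>] randic[OF assms(5)] sombor by simp
qed

end
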